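(* $f_3(n,5,3)= e^{O(\sqrt{\log\log n})}$; that is, there exist constants $C>0$ and $n_0$ such that for all $n\ge n_0$ there is an edge-coloring of the complete $3$-uniform hypergraph $K_n^3$ with at most $e^{C\sqrt{\log\log n}}$ colors in which, for every set of five vertices, the ten edges (triples) spanned by those five vertices receive at least three distinct colors.
   Context: $K_n^3$ denotes the complete $3$-uniform hypergraph on $n$ vertices (all $3$-element subsets of an $n$-element vertex set). A $(p,q)$-coloring of $K_n^k$ is an edge-coloring of $K_n^k$ in which every copy of $K_p^k$ (i.e. the set of all $k$-subsets of any $p$ vertices) receives at least $q$ distinct colors. $f_k(n,p,q)$ denotes the minimum number of colors in a $(p,q)$-coloring of $K_n^k$. *)

theory Defs
  imports Complex_Main "HOL-Library.Ramsey" "HOL-Library.Nat_Bijection"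
begin

text \<open>The edge set of the complete \<open>k\<close>-uniform hypergraph on \<open>V\<close> is \<open>[V]\<^bsup>k\<^esup>\<close>
  (constant \<open>nsets\<close>). Values of a colouring outside \<open>[V]\<^bsup>k\<^esup>\<close> are irrelevant.\<close>

definition pq_coloring ::
    "nat \<Rightarrow> nat \<Rightarrow> nat \<Rightarrow> 'a set \<Rightarrow> ('a set \<Rightarrow> 'c) \<Rightarrow> bool" where
  "pq_coloring k p q V \<chi> \<longleftrightarrow> (\<forall>S \<in> [V]\<^bsup>p\<^esup>. q \<le> card (\<chi> ` [S]\<^bsup>k\<^esup>))"

definition num_colors :: "nat \<Rightarrow> 'a set \<Rightarrow> ('a set \<Rightarrow> 'c) \<Rightarrow> nat" where
  "num_colors k V \<chi> = card (\<chi> ` [V]\<^bsup>k\<^esup>)"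

text \<open>This is \<open>f\<^sub>k(n,p,q)\<close>. The value is meaningful whenever some \<open>(p,q)\<close>-colouring exists,
  in particular when \<open>q \<le> p choose k\<close>; see \<open>pq_number_le_iff\<close> below.\<close>

definition pq_number :: "nat \<Rightarrow> nat \<Rightarrow> nat \<Rightarrow> nat \<Rightarrow> nat" where
  "pq_number k n p q =
     (LEAST m. \<exists>\<chi> :: nat set \<Rightarrow> nat. pq_coloring k p q {..<n} \<chi> \<and> num_colors k {..<n} \<chi> = m)"

lemma pq_coloring_exists:
  assumes "q \<le> p choose k"
  shows "pq_coloring k p q {..<n::nat} set_encode"
  unfolding pq_coloring_def
proof
  fix S assume S: "S \<in> [{..<n}]\<^bsup>p\<^esup>"
  have "inj_on set_encode ([S]\<^bsup>k\<^esup>)"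
    by (rule inj_on_subset[OF inj_on_set_encode]) (auto simp: nsets_def)
  then have "card (set_encode ` [S]\<^bsup>k\<^esup>) = card ([S]\<^bsup>k\<^esup>)"
    by (rule card_image)
  also have "\<dots> = p choose k"
  proof -
    have "finite S" "card S = p" using S by (auto simp: nsets_def)
    moreover from this have "[S]\<^bsup>k\<^esup> = {T. T \<subseteq> S \<and> card T = k}"
      by (auto simp: nsets_def dest: finite_subset)
    ultimately show ?thesis by (simp add: n_subsets)
  qed
  finally show "q \<le> card (set_encode ` [S]\<^bsup>k\<^esup>)" using assms by simp
qed

lemma pq_number_le_iff:
  fixes x :: real
  assumes "q \<le> p choose k"
  shows "real (pq_number k n p q) \<le> x \<longleftrightarrow>
    (\<exists>\<chi> :: nat set \<Rightarrow> nat. pq_coloring k p q {..<n} \<chi> \<and> real (num_colors k {..<n} \<chi>) \<le> x)"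
proof
  let ?P = "\<lambda>m. \<exists>\<chi> :: nat set \<Rightarrow> nat. pq_coloring k p q {..<n} \<chi> \<and> num_colors k {..<n} \<chi> = m"
  assume le: "real (pq_number k n p q) \<le> x"
  have "?P (num_colors k {..<n} set_encode)"
    using pq_coloring_exists[OF assms] by blast
  then have "?P (pq_number k n p q)"
    unfolding pq_number_def by (rule LeastI)
  then show "\<exists>\<chi> :: nat set \<Rightarrow> nat.
      pq_coloring k p q {..<n} \<chi> \<and> real (num_colors k {..<n} \<chi>) \<le> x"
    using le by auto
next
  assume "\<exists>\<chi> :: nat set \<Rightarrow> nat.
    pq_coloring k p q {..<n} \<chi> \<and> real (num_colors k {..<n} \<chi>) \<le> x"
  then obtain \<chi> :: "nat set \<Rightarrow> nat" where
    \<chi>: "pq_coloring k p q {..<n} \<chi>" "real (num_colors k {..<n} \<chi>) \<le> x" by blast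
  have "pq_number k n p q \<le> num_colors k {..<n} \<chi>"
    unfolding pq_number_def using \<chi>(1) by (intro Least_le) blast
  then show "real (pq_number k n p q) \<le> x" using \<chi>(2) by linarith
qed

end

(* Identify the vertices with 0-1 strings of length L = b^t, and let delta(x, y) be the highest
   position in which x and y differ.  A triple x < y < z determines two distinct levels
   delta(x, y) and delta(y, z); colour it by which of them is larger together with a colour psi
   of the pair of levels.  Here the levels are written with t digits in base b, and psi of a
   pair of levels u > v records the highest position where their digits differ, the two digits
   there, and the set of all positions where they differ.
   The levels of five vertices form a binary tree with four inner nodes: a chain, a root with
   subtrees of 2 and 3 leaves, or a root above a node with two subtrees of 2 leaves.  In each
   case three elementary properties of psi rule out two colours.  Taking b = 2^t and t of order
   sqrt(log log n) makes 2^(b^t) >= n, while the number of colours is 2^O(t). *)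
theory Submission
  imports Defs
begin

section \<open>Digits in base \<open>b\<close> and the highest differing position\<close>

definition digit :: "nat \<Rightarrow> nat \<Rightarrow> nat \<Rightarrow> nat" where
  "digit b x i = x div b ^ i mod b"

text \<open>\<open>Suc i\<close> makes the test compare only the digits strictly above position
  \<open>i\<close>. For \<open>1 < b\<close> and distinct arguments the value is the highest
  differing position; for equal arguments it is 0.\<close>

definition top_diff :: "nat \<Rightarrow> nat \<Rightarrow> nat \<Rightarrow> nat" where
  "top_diff b x y = (LEAST i. x div b ^ Suc i = y div b ^ Suc i)"

lemma mod_less_mod_iff_if_div_eq:
  fixes m n b :: nat
  assumes "m div b = n div b"
  shows "m mod b < n mod b \<longleftrightarrow> m < n"
proof -
  have "m = n div b * b + m mod b" using div_mult_mod_eq[of m b] unfolding assms by simp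
  moreover have "n = n div b * b + n mod b" by simp
  ultimately show ?thesis by linarith
qed

lemma div_power_eq_mono:
  fixes x y b :: nat
  assumes "x div b ^ i = y div b ^ i" "i \<le> j"
  shows "x div b ^ j = y div b ^ j"
proof -
  have "b ^ j = b ^ i * b ^ (j - i)"
    using assms(2) by (simp flip: power_add)
  then show ?thesis using assms(1) by (simp add: div_mult2_eq)
qed

lemma div_power_top_diff:
  assumes "1 < b"
  shows "x div b ^ Suc (top_diff b x y) = y div b ^ Suc (top_diff b x y)"
proof -
  \<comment> \<open>Any exponent above which both numbers vanish shows that the \<open>LEAST\<close>
    is attained; \<open>x + y\<close> is a convenient one.\<close>
  have "x < b ^ Suc (x + y)" "y < b ^ Suc (x + y)"
    using less_exp[of "Suc (x + y)"] power_mono[of 2 b "Suc (x + y)"] assms by linarith+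
  then have "x div b ^ Suc (x + y) = y div b ^ Suc (x + y)"
    by (simp only: div_less)
  then show ?thesis unfolding top_diff_def by (rule LeastI)
qed

lemma top_diff_le_iff:
  assumes "1 < b"
  shows "top_diff b x y \<le> i \<longleftrightarrow> x div b ^ Suc i = y div b ^ Suc i"
proof
  assume "top_diff b x y \<le> i"
  then show "x div b ^ Suc i = y div b ^ Suc i"
    using div_power_eq_mono[OF div_power_top_diff[OF assms], of x y "Suc i"] by simp
next
  assume "x div b ^ Suc i = y div b ^ Suc i"
  then show "top_diff b x y \<le> i" unfolding top_diff_def by (rule Least_le)
qed

lemma digit_top_diff_less:
  assumes "1 < b" "x < y"
  shows "digit b x (top_diff b x y) < digit b y (top_diff b x y)"
proof -
  let ?i = "top_diff b x y"
  have ne: "x div b ^ ?i \<noteq> y div b ^ ?i"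
  proof (cases ?i)
    case 0
    then show ?thesis using assms by simp
  next
    case (Suc j)
    then show ?thesis using top_diff_le_iff[OF assms(1), of x y j] by simp
  qed
  moreover have "x div b ^ ?i \<le> y div b ^ ?i"
    using assms by (simp add: div_le_mono)
  moreover have "x div b ^ ?i div b = y div b ^ ?i div b"
    using div_power_top_diff[OF assms(1), of x y] by (simp only: power_Suc2 div_mult2_eq)
  ultimately show ?thesis
    unfolding digit_def by (simp add: mod_less_mod_iff_if_div_eq)
qed

lemma top_diff_less:
  assumes "1 < b" "x < b ^ L" "y < b ^ L" "x \<noteq> y"
  shows "top_diff b x y < L"
proof (cases L)
  case 0
  then show ?thesis using assms by simp
next
  case (Suc k)
  then show ?thesis using assms top_diff_le_iff[OF assms(1), of x y k] by simp
qed

text \<open>Deleting low digits is monotone, so \<open>x\<close> and \<open>z\<close> share a prefix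
  exactly when \<open>y\<close> shares it with both.\<close>

lemma top_diff_eq_max:
  assumes "1 < b" "x \<le> y" "y \<le> z"
  shows "top_diff b x z = max (top_diff b x y) (top_diff b y z)"
proof (rule order_class.order.antisym)
  have "x div b ^ k \<le> y div b ^ k" "y div b ^ k \<le> z div b ^ k" for k
    using assms by (simp_all add: div_le_mono)
  then have "x div b ^ k = z div b ^ k \<longleftrightarrow>
      x div b ^ k = y div b ^ k \<and> y div b ^ k = z div b ^ k" for k
    using order_class.order.antisym[of "x div b ^ k" "y div b ^ k"] by auto
  then have "top_diff b x z \<le> i \<longleftrightarrow> max (top_diff b x y) (top_diff b y z) \<le> i" for i
    unfolding max.bounded_iff top_diff_le_iff[OF assms(1)] by blast
  then show "top_diff b x z \<le> max (top_diff b x y) (top_diff b y z)"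
    "max (top_diff b x y) (top_diff b y z) \<le> top_diff b x z" by blast+
qed

text \<open>At a common level the binary digits of \<open>x\<close>, \<open>y\<close>,
  \<open>z\<close> would increase strictly twice, which two digit values do not allow.\<close>

lemma top_diff_2_neq:
  assumes "x < y" "y < z"
  shows "top_diff 2 x y \<noteq> top_diff 2 y z"
proof
  assume eq: "top_diff 2 x y = top_diff 2 y z"
  have "digit 2 z i < 2" for i by (simp add: digit_def)
  from this[of "top_diff 2 y z"] show False
    using digit_top_diff_less[of 2 x y] digit_top_diff_less[of 2 y z] assms eq by simp
qed

section \<open>Colours of pairs of levels\<close>

definition diff_digits :: "nat \<Rightarrow> nat \<Rightarrow> nat \<Rightarrow> nat set" where
  "diff_digits b u v = {j. digit b u j \<noteq> digit b v j}"

text \<open>The larger level comes first. The position and the two digits serve the consecutive and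
  nested patterns below; the set of differing positions serves the cross pattern.\<close>

definition pair_color :: "nat \<Rightarrow> nat \<Rightarrow> nat \<Rightarrow> nat \<times> nat \<times> nat \<times> nat set" where
  "pair_color b u v =
    (let i = top_diff b v u in (i, digit b u i, digit b v i, diff_digits b u v))"

lemma pair_color_eqD:
  assumes "pair_color b u v = pair_color b u' v'"
  shows "top_diff b v u = top_diff b v' u'"
    and "digit b u (top_diff b v u) = digit b u' (top_diff b v' u')"
    and "digit b v (top_diff b v u) = digit b v' (top_diff b v' u')"
    and "diff_digits b u v = diff_digits b u' v'"
  using assms unfolding pair_color_def Let_def prod.inject by blast+

text \<open>Otherwise \<open>v\<close>, being the smaller level of one pair, would have at the
  common position the same digit as \<open>w\<close>, yet there it exceeds \<open>w\<close>.\<close>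

lemma pair_color_neq_consecutive:
  assumes "1 < b" "w < v" "v < u"
  shows "pair_color b u v \<noteq> pair_color b v w"
proof
  assume eq: "pair_color b u v = pair_color b v w"
  show False
    using digit_top_diff_less[OF assms(1,2)] pair_color_eqD(1,3)[OF eq] by simp
qed

text \<open>If the last two colours agreed, \<open>r\<close> would share the digit of
  \<open>d\<close> at the top position where \<open>d\<close> and \<open>c\<close> differ. That
  position would then separate \<open>r\<close> from \<open>c\<close> but not from \<open>d\<close>,
  while the pairs with \<open>d\<close> and \<open>c\<close> have equal difference sets.\<close>

lemma pair_color_neq_cross:
  assumes "1 < b" "c < d" "pair_color b r d = pair_color b r c"
  shows "pair_color b r a \<noteq> pair_color b d c"
proof
  let ?j = "top_diff b c d"
  assume eq: "pair_color b r a = pair_color b d c"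
  have "digit b r ?j = digit b d ?j"
    using pair_color_eqD(2)[OF eq] unfolding pair_color_eqD(1)[OF eq] .
  moreover have "digit b d ?j \<noteq> digit b c ?j"
    using digit_top_diff_less[OF assms(1,2)] by simp
  ultimately have "?j \<notin> diff_digits b r d" "?j \<in> diff_digits b r c"
    by (simp_all add: diff_digits_def)
  then show False using pair_color_eqD(4)[OF assms(3)] by simp
qed

text \<open>With all three colours equal, the four levels agree above a common position, where
  \<open>y\<close> has the digit of \<open>w\<close> and \<open>x\<close> the smaller digit of
  \<open>z\<close>. This contradicts \<open>y < x\<close>.\<close>

lemma pair_color_neq_nested:
  assumes "1 < b" "z < y" "y < x" "x < w" "pair_color b w z = pair_color b w x"
  shows "pair_color b w z \<noteq> pair_color b y z"
proof
  let ?i = "top_diff b z w"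
  note wx = pair_color_eqD[OF assms(5)]
  assume "pair_color b w z = pair_color b y z"
  note yz = pair_color_eqD[OF this]
  have "x div b ^ Suc ?i = w div b ^ Suc ?i"
    using div_power_top_diff[OF assms(1), of x w] unfolding wx(1)[symmetric] .
  moreover have "z div b ^ Suc ?i = y div b ^ Suc ?i"
    using div_power_top_diff[OF assms(1), of z y] unfolding yz(1)[symmetric] .
  moreover have "z div b ^ Suc ?i = w div b ^ Suc ?i"
    by (rule div_power_top_diff[OF assms(1)])
  ultimately have "x div b ^ Suc ?i = y div b ^ Suc ?i" by argo
  then have "x div b ^ ?i div b = y div b ^ ?i div b"
    by (simp only: power_Suc2 div_mult2_eq)
  moreover have "y div b ^ ?i \<le> x div b ^ ?i"
    using assms(3) by (simp add: div_le_mono)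
  ultimately have "digit b y ?i \<le> digit b x ?i"
    unfolding digit_def by (simp add: mod_less_mod_iff_if_div_eq flip: not_less)
  moreover have "digit b w ?i = digit b y ?i" using yz(2) unfolding yz(1)[symmetric] .
  moreover have "digit b z ?i = digit b x ?i" using wx(3) unfolding wx(1)[symmetric] .
  moreover have "digit b z ?i < digit b w ?i"
    using assms(2-4) by (intro digit_top_diff_less[OF assms(1)]) linarith
  ultimately show False by linarith
qed

lemma pair_color_range:
  assumes "1 < b" "v < u" "u < b ^ t"
  shows "pair_color b u v \<in> {..<t} \<times> {..<b} \<times> {..<b} \<times> Pow {..<t}"
proof -
  have "top_diff b v u < t" using assms by (simp add: top_diff_less)
  moreover have "digit b x i < b" for x i using assms by (simp add: digit_def)
  moreover have "diff_digits b u v \<subseteq> {..<t}"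
  proof
    fix j assume j: "j \<in> diff_digits b u v"
    show "j \<in> {..<t}"
    proof (rule ccontr)
      assume "j \<notin> {..<t}"
      \<comment> \<open>Both levels have only zero digits from position \<open>t\<close> on.\<close>
      then have "b ^ t \<le> b ^ j" using assms by (simp add: power_increasing)
      then have "u < b ^ j" "v < b ^ j" using assms by linarith+
      then show False using j by (simp add: diff_digits_def digit_def)
    qed
  qed
  ultimately show ?thesis by (simp add: pair_color_def Let_def)
qed

section \<open>Excluding two colours for each tree shape\<close>

text \<open>In the next three lemmas the variables are levels of inner nodes of the binary tree of
  five vertices. The flag paired with the colour of an ancestor and a descendant is \<open>True\<close> iff the
  descendant lies in the right subtree of the ancestor.\<close>

lemma chain_not_two_colors:
  assumes "1 < b" "z < y" "y < x" "x < w"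
    and "(e, pair_color b w x) \<in> {P, Q}" "(e, pair_color b w y) \<in> {P, Q}"
      "(e, pair_color b w z) \<in> {P, Q}" "(e', pair_color b x y) \<in> {P, Q}"
      "(e', pair_color b x z) \<in> {P, Q}" "(e'', pair_color b y z) \<in> {P, Q}"
  shows False
proof -
  \<comment> \<open>If \<open>wx\<close> has colour P, these force Q on \<open>xy\<close> and
    \<open>xz\<close>, then P on \<open>yz\<close> and Q on \<open>wy\<close>. Now Q on
    \<open>wz\<close> is a cross pattern and P on \<open>wz\<close> a nested one.\<close>
  have "pair_color b w x \<noteq> pair_color b x y" "pair_color b w x \<noteq> pair_color b x z"
    "pair_color b x y \<noteq> pair_color b y z" "pair_color b w y \<noteq> pair_color b y z"
    using pair_color_neq_consecutive assms(1-4) by (meson less_trans)+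
  moreover have "pair_color b w y \<noteq> pair_color b w z \<or> pair_color b w x \<noteq> pair_color b y z"
    using pair_color_neq_cross assms(1,2) by blast
  moreover have "pair_color b w z \<noteq> pair_color b w x \<or> pair_color b w z \<noteq> pair_color b y z"
    using pair_color_neq_nested[OF assms(1-4)] by blast
  ultimately show False using assms(5-) by auto
qed

lemma fork_at_root_not_two_colors:
  assumes "1 < b" "c < d" "d < r" "e \<noteq> e'"
    and "(e, pair_color b r a) \<in> {P, Q}" "(e', pair_color b r d) \<in> {P, Q}"
      "(e', pair_color b r c) \<in> {P, Q}" "(e'', pair_color b d c) \<in> {P, Q}"
  shows False
proof -
  \<comment> \<open>The flags separate \<open>ra\<close> from \<open>rd\<close> and
    \<open>rc\<close>, so the latter two share a colour. As \<open>dc\<close> avoids it,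
    \<open>dc\<close> has the colour of \<open>ra\<close>: a cross pattern.\<close>
  have "pair_color b r d \<noteq> pair_color b d c"
    using pair_color_neq_consecutive assms(1-3) by blast
  moreover have "pair_color b r d \<noteq> pair_color b r c \<or> pair_color b r a \<noteq> pair_color b d c"
    using pair_color_neq_cross assms(1,2) by blast
  ultimately show False using assms(4-) by auto
qed

lemma fork_below_root_not_two_colors:
  assumes "1 < b" "c < s" "d < s" "s < r"
    and "(e, pair_color b r s) \<in> {P, Q}" "(e, pair_color b r c) \<in> {P, Q}"
      "(e, pair_color b r d) \<in> {P, Q}"
      "(True, pair_color b s c) \<in> {P, Q}" "(False, pair_color b s d) \<in> {P, Q}"
  shows False
proof -
  \<comment> \<open>The flags make \<open>sc\<close> and \<open>sd\<close> use both colours, leaving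
    none for \<open>rs\<close>.\<close>
  have "pair_color b r s \<noteq> pair_color b s c" "pair_color b r s \<noteq> pair_color b s d"
    using pair_color_neq_consecutive assms(1-4) by blast+
  then show False using assms(5-) by (cases e) auto
qed

text \<open>For a triple, \<open>d\<close> is the level of the left gap and \<open>d'\<close> that
  of the right gap; the larger one is the ancestor.\<close>

definition level_color :: "nat \<Rightarrow> nat \<Rightarrow> nat \<Rightarrow> bool \<times> nat \<times> nat \<times> nat \<times> nat set" where
  "level_color b d d' = (d' < d, pair_color b (max d d') (min d d'))"

lemma level_color_gt: "d' < d \<Longrightarrow> level_color b d d' = (True, pair_color b d d')"
  and level_color_lt: "d < d' \<Longrightarrow> level_color b d d' = (False, pair_color b d' d)"
  by (auto simp: level_color_def max_def min_def)

text \<open>The \<open>d\<close>s are the levels of the four gaps between consecutive vertices, and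
  a maximum is the level of a longer interval. Thus \<open>col\<close> lists all ten triples, and
  \<open>ne\<close> records that the two levels of a triple differ.\<close>

lemma four_levels_not_two_colors:
  assumes b: "1 < b"
    and ne: "d1 \<noteq> d2" "d2 \<noteq> d3" "d3 \<noteq> d4" "d1 \<noteq> max d2 d3" "d2 \<noteq> max d3 d4"
      "d1 \<noteq> max d2 (max d3 d4)"
    and col: "level_color b d1 d2 \<in> {P, Q}" "level_color b d2 d3 \<in> {P, Q}"
      "level_color b d3 d4 \<in> {P, Q}" "level_color b d1 (max d2 d3) \<in> {P, Q}"
      "level_color b d2 (max d3 d4) \<in> {P, Q}" "level_color b (max d1 d2) d3 \<in> {P, Q}"
      "level_color b (max d2 d3) d4 \<in> {P, Q}" "level_color b d1 (max d2 (max d3 d4)) \<in> {P, Q}"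
      "level_color b (max d1 d2) (max d3 d4) \<in> {P, Q}"
      "level_color b (max d1 (max d2 d3)) d4 \<in> {P, Q}"
  shows False
proof -
  note lc = level_color_gt level_color_lt max.absorb3 max.absorb4
  \<comment> \<open>Equal levels occur only at incomparable nodes, which have a larger level between
    them.\<close>
  have "d1 < d3 \<or> d3 < d1 \<or> d1 < d2 \<and> d3 < d2"
    using ne(1,2,4) by linarith
  moreover have "d2 < d4 \<or> d4 < d2 \<or> d2 < d3 \<and> d4 < d3"
    using ne(2,3,5) by linarith
  moreover have "d1 < d4 \<or> d4 < d1 \<or> d1 < d2 \<and> d4 < d2 \<or> d1 < d3 \<and> d4 < d3"
    using ne(1,3,6) by linarith
  \<comment> \<open>These are the 14 binary trees with five leaves: eight chains, four forks at the
    root and two below it.\<close>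
  ultimately consider "d2 < d1" "d3 < d2" "d4 < d3"
    | "d2 < d1" "d4 < d2" "d3 < d4"
    | "d4 < d1" "d2 < d4" "d3 < d2"
    | "d4 < d1" "d3 < d4" "d2 < d3"
    | "d3 < d1" "d4 < d3" "d2 < d3"
    | "d1 < d2" "d3 < d2" "d4 < d3"
    | "d1 < d2" "d4 < d2" "d3 < d4"
    | "d4 < d3" "d1 < d3" "d2 < d1"
    | "d4 < d3" "d2 < d3" "d1 < d2"
    | "d1 < d4" "d2 < d1" "d3 < d2"
    | "d1 < d4" "d3 < d1" "d2 < d3"
    | "d3 < d4" "d1 < d3" "d2 < d1"
    | "d3 < d4" "d2 < d3" "d1 < d2"
    | "d2 < d4" "d3 < d2" "d1 < d2"
    using ne(1-3) by (smt (verit) linorder_neq_iff)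
  then show False
  proof cases
    case 1
    \<comment> \<open>Without \<open>insert_iff\<close>, membership in \<open>{P, Q}\<close> stays
      intact and each premise matches one fact of \<open>col\<close>.\<close>
    with col show ?thesis
      by (intro chain_not_two_colors[OF b, of d4 d3 d2 d1 _ P Q])
        (simp_all add: lc del: insert_iff)
  next
    case 2
    with col show ?thesis
      by (intro chain_not_two_colors[OF b, of d3 d4 d2 d1 _ P Q])
        (simp_all add: lc del: insert_iff)
  next
    case 3
    with col show ?thesis
      by (intro chain_not_two_colors[OF b, of d3 d2 d4 d1 _ P Q])
        (simp_all add: lc del: insert_iff)
  next
    case 4
    with col show ?thesis
      by (intro chain_not_two_colors[OF b, of d2 d3 d4 d1 _ P Q])
        (simp_all add: lc del: insert_iff)
  next
    case 5
    with col show ?thesis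
      by (intro fork_below_root_not_two_colors[OF b, of d4 d3 d2 d1 _ P Q])
        (simp_all add: lc del: insert_iff)
  next
    case 6
    with col show ?thesis
      by (intro fork_at_root_not_two_colors[OF b, of d4 d3 d2 False True d1 P Q])
        (simp_all add: lc del: insert_iff)
  next
    case 7
    with col show ?thesis
      by (intro fork_at_root_not_two_colors[OF b, of d3 d4 d2 False True d1 P Q])
        (simp_all add: lc del: insert_iff)
  next
    case 8
    with col show ?thesis
      by (intro fork_at_root_not_two_colors[OF b, of d2 d1 d3 True False d4 P Q])
        (simp_all add: lc del: insert_iff)
  next
    case 9
    with col show ?thesis
      by (intro fork_at_root_not_two_colors[OF b, of d1 d2 d3 True False d4 P Q])
        (simp_all add: lc del: insert_iff)
  next
    case 10
    with col show ?thesis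
      by (intro chain_not_two_colors[OF b, of d3 d2 d1 d4 _ P Q])
        (simp_all add: lc del: insert_iff)
  next
    case 11
    with col show ?thesis
      by (intro chain_not_two_colors[OF b, of d2 d3 d1 d4 _ P Q])
        (simp_all add: lc del: insert_iff)
  next
    case 12
    with col show ?thesis
      by (intro chain_not_two_colors[OF b, of d2 d1 d3 d4 _ P Q])
        (simp_all add: lc del: insert_iff)
  next
    case 13
    with col show ?thesis
      by (intro chain_not_two_colors[OF b, of d1 d2 d3 d4 _ P Q])
        (simp_all add: lc del: insert_iff)
  next
    case 14
    with col show ?thesis
      by (intro fork_below_root_not_two_colors[OF b, of d3 d2 d1 d4 _ P Q])
        (simp_all add: lc del: insert_iff)
  qed
qed

section \<open>The colouring of triples of vertices\<close>

definition triple_color :: "nat \<Rightarrow> nat set \<Rightarrow> bool \<times> nat \<times> nat \<times> nat \<times> nat set" where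
  "triple_color b T = (let xs = sorted_list_of_set T in
     level_color b (top_diff 2 (xs ! 0) (xs ! 1)) (top_diff 2 (xs ! 1) (xs ! 2)))"

lemma triple_color_eq:
  assumes "x < y" "y < z"
  shows "triple_color b {x, y, z} = level_color b (top_diff 2 x y) (top_diff 2 y z)"
proof -
  have "sorted_list_of_set {x, y, z} = [x, y, z]"
    using assms by (intro sorted_list_of_set_unique[THEN iffD1]) auto
  then show ?thesis by (simp add: triple_color_def)
qed

lemma subset_pair_if_card_le_2:
  assumes "finite A" "card A \<le> 2"
  obtains P Q where "A \<subseteq> {P, Q}"
proof -
  have "card A = 0 \<or> card A = 1 \<or> card A = 2" using assms(2) by linarith
  then have "\<exists>P Q. A \<subseteq> {P, Q}"
    using assms(1) by (auto simp: card_1_singleton_iff card_2_iff)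
  then show ?thesis using that by blast
qed

lemma nsets_sorted_list:
  assumes "S \<in> [V]\<^bsup>k\<^esup>"
  obtains xs :: "nat list" where "S = set xs" "length xs = k" "sorted_wrt (<) xs"
  using assms that[of "sorted_list_of_set S"] by (auto simp: nsets_def)

lemma pq_coloring_triple_color:
  assumes b: "1 < b"
  shows "pq_coloring 3 5 3 V (triple_color b)"
  unfolding pq_coloring_def
proof (intro ballI leI notI)
  fix S :: "nat set"
  assume S: "S \<in> [V]\<^bsup>5\<^esup>" and less_3: "card (triple_color b ` [S]\<^bsup>3\<^esup>) < 3"
  have "finite (triple_color b ` [S]\<^bsup>3\<^esup>)"
    using S by (simp add: nsets_def finite_imp_finite_nsets)
  moreover have "card (triple_color b ` [S]\<^bsup>3\<^esup>) \<le> 2" using less_3 by simp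
  ultimately obtain P Q where PQ: "triple_color b ` [S]\<^bsup>3\<^esup> \<subseteq> {P, Q}"
    by (rule subset_pair_if_card_le_2)
  obtain xs where xs: "S = set xs" "length xs = 5" "sorted_wrt (<) xs"
    using S by (rule nsets_sorted_list)
  obtain x1 x2 x3 x4 x5 where "xs = [x1, x2, x3, x4, x5]"
    using xs(2) by (auto simp: numeral_eq_Suc length_Suc_conv)
  then have S_eq: "S = {x1, x2, x3, x4, x5}" and less: "x1 < x2" "x2 < x3" "x3 < x4" "x4 < x5"
    using xs by auto
  have col: "level_color b (top_diff 2 x y) (top_diff 2 y z) \<in> {P, Q}"
    if "x < y" "y < z" "{x, y, z} \<subseteq> S" for x y z
  proof -
    have "{x, y, z} \<in> [S]\<^bsup>3\<^esup>" using that by (auto simp: nsets_def)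
    then have "triple_color b {x, y, z} \<in> {P, Q}" using PQ by blast
    then show ?thesis unfolding triple_color_eq[OF that(1,2)] .
  qed
  have top_diff:
    "top_diff 2 x1 x3 = max (top_diff 2 x1 x2) (top_diff 2 x2 x3)"
    "top_diff 2 x2 x4 = max (top_diff 2 x2 x3) (top_diff 2 x3 x4)"
    "top_diff 2 x3 x5 = max (top_diff 2 x3 x4) (top_diff 2 x4 x5)"
    "top_diff 2 x1 x4 = max (top_diff 2 x1 x2) (top_diff 2 x2 x4)"
    "top_diff 2 x2 x5 = max (top_diff 2 x2 x3) (top_diff 2 x3 x5)"
    using less by (simp_all add: top_diff_eq_max)
  show False
    \<comment> \<open>Folding \<open>top_diff\<close> backwards turns each maximum into the level of
      two vertices, so every premise concerns a single triple.\<close>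
    by (rule four_levels_not_two_colors[OF b, of "top_diff 2 x1 x2" "top_diff 2 x2 x3"
          "top_diff 2 x3 x4" "top_diff 2 x4 x5" P Q]; (unfold top_diff[symmetric])?;
        rule top_diff_2_neq col; use less in \<open>simp add: S_eq\<close>)
qed

lemma triple_color_range:
  assumes "1 < b" "T \<in> [{..<2 ^ b ^ t}]\<^bsup>3\<^esup>"
  shows "triple_color b T \<in> UNIV \<times> {..<t} \<times> {..<b} \<times> {..<b} \<times> Pow {..<t}"
proof -
  obtain xs where xs: "T = set xs" "length xs = 3" "sorted_wrt (<) xs"
    using assms(2) by (rule nsets_sorted_list)
  obtain x y z where "xs = [x, y, z]"
    using xs(2) by (auto simp: numeral_eq_Suc length_Suc_conv)
  then have T: "T = {x, y, z}" and less: "x < y" "y < z" using xs by auto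
  moreover have "z < 2 ^ b ^ t" using assms(2) T by (auto simp: nsets_def)
  ultimately have "top_diff 2 x y < b ^ t" "top_diff 2 y z < b ^ t"
    by (simp_all add: top_diff_less)
  then have "pair_color b (max (top_diff 2 x y) (top_diff 2 y z))
      (min (top_diff 2 x y) (top_diff 2 y z)) \<in> {..<t} \<times> {..<b} \<times> {..<b} \<times> Pow {..<t}"
    using top_diff_2_neq[OF less] by (intro pair_color_range[OF assms(1)]) auto
  then show ?thesis unfolding T triple_color_eq[OF less] level_color_def by simp
qed

section \<open>Counting colours and choosing parameters\<close>

lemma pq_number_le_card:
  assumes "pq_coloring k p q {..<n} \<chi>" "\<chi> ` [{..<n}]\<^bsup>k\<^esup> \<subseteq> F" "finite F"
  shows "pq_number k n p q \<le> card F"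
proof -
  \<comment> \<open>\<open>pq_number\<close> ranges over colourings by naturals, so the colours are
    renamed injectively.\<close>
  obtain g :: "'a \<Rightarrow> nat" where g: "inj_on g F"
    using finite_imp_inj_to_nat_seg[OF assms(3)] by blast
  have card_eq: "card ((g \<circ> \<chi>) ` [S]\<^bsup>k\<^esup>) = card (\<chi> ` [S]\<^bsup>k\<^esup>)" if "S \<subseteq> {..<n}" for S
  proof -
    have "\<chi> ` [S]\<^bsup>k\<^esup> \<subseteq> F" using nsets_mono[OF that, of k] assms(2) by blast
    then show ?thesis unfolding image_comp[symmetric] by (metis card_image g inj_on_subset)
  qed
  have "pq_coloring k p q {..<n} (g \<circ> \<chi>)"
    using assms(1) card_eq unfolding pq_coloring_def by (auto simp: nsets_def)
  then have "pq_number k n p q \<le> num_colors k {..<n} (g \<circ> \<chi>)"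
    unfolding pq_number_def by (intro Least_le) blast
  also have "\<dots> = card (\<chi> ` [{..<n}]\<^bsup>k\<^esup>)"
    unfolding num_colors_def by (rule card_eq) simp
  also have "\<dots> \<le> card F" using assms(2,3) by (rule card_mono[rotated])
  finally show ?thesis .
qed

text \<open>Base \<open>2 ^ t\<close> with \<open>t\<close> digits gives
  \<open>2 ^ t\<^sup>2\<close> levels, while every component of a colour has at most
  \<open>2 ^ t\<close> values; five components give \<open>32 ^ t\<close>.\<close>

lemma pq_number_3_5_3_le:
  assumes "1 \<le> t" "n \<le> 2 ^ 2 ^ t\<^sup>2"
  shows "pq_number 3 n 5 3 \<le> 32 ^ t"
proof -
  let ?b = "2 ^ t :: nat"
  let ?F = "(UNIV :: bool set) \<times> {..<t} \<times> {..<?b} \<times> {..<?b} \<times> Pow {..<t}"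
  have b: "1 < ?b" using assms(1) one_less_power[of "2 :: nat" t] by linarith
  have "?b ^ t = 2 ^ t\<^sup>2" by (simp add: power_mult power2_eq_square)
  then have "{..<n} \<subseteq> {..<2 ^ ?b ^ t}" using assms(2) by simp
  then have "triple_color ?b ` [{..<n}]\<^bsup>3\<^esup> \<subseteq> ?F"
    using triple_color_range[OF b] nsets_mono by blast
  then have "pq_number 3 n 5 3 \<le> card ?F"
    by (intro pq_number_le_card[OF pq_coloring_triple_color[OF b]]) auto
  also have "\<dots> = 2 * (t * (2 ^ t * (2 ^ t * 2 ^ t)))"
    by (simp add: card_cartesian_product card_Pow)
  also have "\<dots> \<le> 2 ^ t * (2 ^ t * (2 ^ t * (2 ^ t * 2 ^ t)))"
    using assms(1) by (intro mult_mono) (auto intro: self_le_power less_imp_le)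
  also have "\<dots> = 32 ^ t" by (simp flip: power_mult_distrib)
  finally show ?thesis .
qed

theorem mainTheorem1:
  shows "\<exists>C :: real. C > 0 \<and> (\<exists>n0 :: nat. \<forall>n \<ge> n0.
    real (pq_number 3 n 5 3) \<le> exp (C * sqrt (ln (ln (real n)))))"
\<comment> \<open>The threshold ensures \<open>ln (ln n)\<close> is at least 1. The constant is 15 =
  3 * 5, from \<open>t \<le> 3 * s\<close> and \<open>32 \<le> exp 5\<close>.\<close>
proof (intro exI[of _ "15 :: real"] exI[of _ "nat \<lceil>exp (exp 1 :: real)\<rceil>"] conjI allI impI)
  fix n assume "n \<ge> nat \<lceil>exp (exp 1 :: real)\<rceil>"
  then have n: "exp (exp 1) \<le> real n" by linarith
  then have n_pos: "0 < real n" by (meson exp_gt_zero less_le_trans)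
  have ln_n: "exp 1 \<le> ln (real n)" using n n_pos by (simp add: ln_ge_iff)
  then have ln_n_pos: "0 < ln (real n)" by (meson exp_gt_zero less_le_trans)
  define s where "s = sqrt (ln (ln (real n)))"
  have "1 \<le> ln (ln (real n))" using ln_n ln_n_pos by (simp add: ln_ge_iff)
  then have s: "1 \<le> s" "s\<^sup>2 = ln (ln (real n))" by (simp_all add: s_def)
  \<comment> \<open>The factor 2 gives \<open>t\<^sup>2 / 2 \<ge> 2 * ln (ln n)\<close>, hence
    \<open>2 ^ t\<^sup>2 \<ge> (ln n)\<^sup>2 \<ge> 2 * ln n\<close>. One more use of
    \<open>pow\<close> reaches \<open>n\<close>.\<close>
  define t where "t = nat \<lceil>2 * s\<rceil>"
  have t: "2 * s \<le> real t" "real t \<le> 3 * s" "1 \<le> t" using s(1) unfolding t_def by linarith+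
  have ln2: "1 / 2 \<le> ln (2 :: real)" using exp_half_le2 by (metis ln_ge_iff zero_less_numeral)
  have pow: "exp (x / 2) \<le> 2 ^ k" if "x \<le> real k" for x k
  proof -
    have "x / 2 \<le> real k * ln 2"
      using mult_mono[OF that ln2] that by (cases "0 \<le> x") (auto intro: order_trans[of _ 0])
    then show ?thesis by (metis exp_le_cancel_iff exp_of_nat_mult exp_ln zero_less_numeral)
  qed
  have "(2 * s)\<^sup>2 \<le> (real t)\<^sup>2" using t(1) s(1) by (intro power_mono) auto
  then have "exp ((2 * s)\<^sup>2 / 2) \<le> 2 ^ t\<^sup>2" by (intro pow) simp
  also have "(2 * s)\<^sup>2 / 2 = ln (ln (real n)) + ln (ln (real n))"
    by (simp add: power_mult_distrib s(2))
  finally have "ln (real n) * ln (real n) \<le> 2 ^ t\<^sup>2"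
    unfolding exp_add exp_ln[OF ln_n_pos] .
  moreover have "2 \<le> ln (real n)" using ln_n exp_ge_add_one_self[of 1] by linarith
  then have "2 * ln (real n) \<le> ln (real n) * ln (real n)"
    using ln_n_pos by (intro mult_right_mono) auto
  ultimately have "exp (2 * ln (real n) / 2) \<le> 2 ^ 2 ^ t\<^sup>2" by (intro pow) simp
  then have "real n \<le> real (2 ^ 2 ^ t\<^sup>2)" using n_pos by simp
  then have "n \<le> 2 ^ 2 ^ t\<^sup>2" by (simp only: of_nat_le_iff)
  then have "pq_number 3 n 5 3 \<le> 32 ^ t" by (rule pq_number_3_5_3_le[OF t(3)])
  then have "real (pq_number 3 n 5 3) \<le> 32 ^ t"
    by (metis of_nat_le_iff of_nat_numeral of_nat_power)
  also have "\<dots> \<le> exp 5 ^ t"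
  proof (rule power_mono)
    have "(2 :: real) ^ 5 \<le> exp 1 ^ 5"
      using exp_ge_add_one_self[of 1] by (intro power_mono) auto
    then show "32 \<le> exp (5 :: real)" by (simp flip: exp_of_nat_mult)
  qed simp
  also have "\<dots> = exp (real t * 5)" by (simp add: exp_of_nat_mult)
  also have "\<dots> \<le> exp (15 * s)" using t(2) by simp
  finally show "real (pq_number 3 n 5 3) \<le> exp (15 * sqrt (ln (ln (real n))))"
    by (simp add: s_def)
qed simp

end
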